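(* Let $f\colon I\to I$ be a long-zigzag map which is locally eventually onto. Then every $B$-endpoint of $\varprojlim\{I,f\}$ is an endpoint of $\varprojlim\{I,f\}$. In particular, the set of $B$-endpoints, the set of $L$-endpoints and the set of endpoints of $\varprojlim\{I,f\}$ are the same.
   Context: $I=[0,1]$, $\mathbb{N}=\{1,2,\dots\}$, $\mathbb{N}_0=\mathbb{N}\cup\{0\}$. A map $f\colon I\to I$ always means a continuous surjection; $f^n$ is the $n$-th iterate ($f^0=\mathrm{id}$). The inverse limit is $\varprojlim\{I,f\}=\{(x_0,x_1,\ldots)\in I^{\mathbb{N}_0}: f(x_i)=x_{i-1},\ i\in\mathbb{N}\}$ with the product topology; $\pi_i((x_0,x_1,\ldots))=x_i$ are the coordinate projections. It is a chainable continuum (a continuum is a nonempty compact connected metric space). Long-zigzag: $f\colon I\to I$ is long-zigzag if there exists $\varepsilon>0$ such that for every $n\in\mathbb{N}_0$ and every interval $[a,b]\subset I$ such that $f^n([a,b])=[f^n(a),f^n(b)]$ or $f^n([a,b])=[f^n(b),f^n(a)]$, $f^n(x)\notin\{f^n(a),f^n(b)\}$ for every $x\in(a,b)$, and $|f^n(a)-f^n(b)|<\varepsilon$, the map $f^n$ sends $[a,b]$ homeomorphically onto $f^n([a,b])$. Locally eventually onto (leo): for every nondegenerate interval $[a,b]\subset I$ there exists $n\in\mathbb{N}$ such that $f^n([a,b])=I$. Let $X=\varprojlim\{I,f\}$ and $x\in X$. - $x$ is an endpoint if for all subcontinua $A,B\subset X$ with $x\in A\cap B$ one has $A\subset B$ or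 $B\subset A$. - $x$ is an $L$-endpoint if $x$ is an endpoint of every arc in $X$ which contains it (in particular, $x$ is an $L$-endpoint if it lies in no arc of $X$). - For $i\in\mathbb{N}_0$, the $i$-basic arc $A_i(x)$ is the maximal arc in $X$ such that $x\in A_i(x)$ and $\pi_i|_{A_i(x)}$ is one-to-one; it can be degenerate, i.e. equal to $\{x\}$. - $x$ is a $B$-endpoint if it is an endpoint of the arc $A_i(x)$ for every $i\in\mathbb{N}_0$ (the point of a degenerate arc counts as its endpoint). *)

theory Defs
  imports "HOL-Analysis.Analysis"
begin

(* A map I -> I is a function real => real of which only the restriction to {0..1} matters. *)

definition long_zigzag :: "(real \<Rightarrow> real) \<Rightarrow> bool" where
  "long_zigzag f \<longleftrightarrow>
    (\<exists>\<epsilon>>0. \<forall>n a b.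
       0 \<le> a \<and> a \<le> b \<and> b \<le> 1 \<and>
       ((f ^^ n) ` {a..b} = {(f ^^ n) a..(f ^^ n) b} \<or>
        (f ^^ n) ` {a..b} = {(f ^^ n) b..(f ^^ n) a}) \<and>
       (\<forall>x\<in>{a<..<b}. (f ^^ n) x \<notin> {(f ^^ n) a, (f ^^ n) b}) \<and>
       \<bar>(f ^^ n) a - (f ^^ n) b\<bar> < \<epsilon>
       \<longrightarrow> (\<exists>g. homeomorphism {a..b} ((f ^^ n) ` {a..b}) (f ^^ n) g))"

definition locally_eventually_onto :: "(real \<Rightarrow> real) \<Rightarrow> bool" where
  "locally_eventually_onto f \<longleftrightarrow>
    (\<forall>a b. 0 \<le> a \<and> a < b \<and> b \<le> 1 \<longrightarrow> (\<exists>n\<ge>1. (f ^^ n) ` {a..b} = {0..1}))"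

(* The topology used on nat => real is the one of its topological_space instance,
   i.e. the product topology. *)
definition inverse_limit :: "(real \<Rightarrow> real) \<Rightarrow> (nat \<Rightarrow> real) set" where
  "inverse_limit f = {x. (\<forall>i. x i \<in> {0..1}) \<and> (\<forall>i\<ge>1. f (x i) = x (i - 1))}"

definition subcontinuum :: "'a::topological_space set \<Rightarrow> 'a set \<Rightarrow> bool" where
  "subcontinuum X A \<longleftrightarrow> A \<subseteq> X \<and> A \<noteq> {} \<and> compact A \<and> connected A"

definition endpoints :: "'a::topological_space set \<Rightarrow> 'a set" where
  "endpoints X = {x \<in> X. \<forall>A B. subcontinuum X A \<and> subcontinuum X B \<and> x \<in> A \<inter> B
                     \<longrightarrow> A \<subseteq> B \<or> B \<subseteq> A}"

(* Arcs as point sets. In a Hausdorff space the injective path g is a homeomorphism from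
   {0..1} onto A, and the two endpoints of A do not depend on the choice of g. *)
definition nondegenerate_arc :: "'a::topological_space set \<Rightarrow> bool" where
  "nondegenerate_arc A \<longleftrightarrow> (\<exists>g. arc g \<and> path_image g = A)"

definition arc_or_point :: "'a::topological_space set \<Rightarrow> bool" where
  "arc_or_point A \<longleftrightarrow> nondegenerate_arc A \<or> (\<exists>y. A = {y})"

definition arc_endpoint :: "'a::topological_space set \<Rightarrow> 'a \<Rightarrow> bool" where
  "arc_endpoint A p \<longleftrightarrow>
    A = {p} \<or> (\<exists>g. arc g \<and> path_image g = A \<and> (p = pathstart g \<or> p = pathfinish g))"

definition L_endpoints :: "'a::topological_space set \<Rightarrow> 'a set" where
  "L_endpoints X = {x \<in> X. \<forall>A. nondegenerate_arc A \<and> A \<subseteq> X \<and> x \<in> A \<longrightarrow> arc_endpoint A x}"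

(* A is an i-basic arc of x: maximal with respect to inclusion among the (possibly degenerate)
   arcs in X that contain x and on which the i-th projection is one-to-one. This is a
   relation because A need not be unique: if the i-th projection folds at an interior point x
   of an arc, there is one maximal arc on each side of the fold, with x an endpoint of both. *)
definition is_basic_arc ::
    "(nat \<Rightarrow> real) set \<Rightarrow> nat \<Rightarrow> (nat \<Rightarrow> real) \<Rightarrow> (nat \<Rightarrow> real) set \<Rightarrow> bool" where
  "is_basic_arc X i x A \<longleftrightarrow>
    (let candidate = (\<lambda>C. arc_or_point C \<and> C \<subseteq> X \<and> x \<in> C \<and> inj_on (\<lambda>y. y i) C)
     in candidate A \<and> (\<forall>C. candidate C \<and> A \<subseteq> C \<longrightarrow> C = A))"

definition B_endpoints :: "(nat \<Rightarrow> real) set \<Rightarrow> (nat \<Rightarrow> real) set" where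
  "B_endpoints X = {x \<in> X. \<forall>i. \<exists>A. is_basic_arc X i x A \<and> arc_endpoint A x}"

end

theory Submission
  imports Defs
begin

text \<open>
  Write \<open>X\<close> for the inverse limit and \<open>y n\<close> for the \<open>n\<close>-th coordinate of a point \<open>y\<close>. The heart of the
  matter is that every point \<open>x\<close> of \<open>X\<close> that is not an endpoint has an arc of \<open>X\<close> through it on which
  some coordinate is injective and takes values on both sides of the value at \<open>x\<close>
  (\<open>local_section_at_non_endpoint\<close>).

  Let \<open>A\<close> and \<open>B\<close> be subcontinua containing \<open>x\<close>, with \<open>p\<close> in \<open>A - B\<close> and \<open>q\<close> in \<open>B - A\<close>. From some
  coordinate \<open>N\<close> on, \<open>p\<close> is separated from \<open>B\<close> and \<open>q\<close> from \<open>A\<close>. Because \<open>f\<close> is locally eventually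
  onto, an interval that is not short is spread over \<open>{0..1}\<close> by a bounded number of steps; so the
  projections of the proper subcontinua \<open>A\<close> and \<open>B\<close> shrink to length zero
  (\<open>proper_subcontinuum_coords_shrink\<close>), and \<open>N\<close> can be taken such that \<open>p N\<close> and \<open>q N\<close> are closer than
  the constant \<open>\<epsilon>\<close> of the long-zigzag property. Say \<open>p N < q N\<close>. On the projection of \<open>A\<close> to
  coordinate \<open>N + k\<close> the iterate \<open>f ^^ k\<close> stays below \<open>q N\<close>, and on that of \<open>B\<close> it stays above \<open>p N\<close>.
  Going from \<open>x (N + k)\<close> through one projection to the nearest point over \<open>p N\<close>, and through the other
  to the nearest point over \<open>q N\<close>, gives an interval around \<open>x (N + k)\<close> whose interior is mapped by
  \<open>f ^^ k\<close> strictly between \<open>p N\<close> and \<open>q N\<close> and whose ends are mapped onto these two values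
  (\<open>clean_window\<close>). This is the situation of the long-zigzag property, so \<open>f ^^ k\<close> is a homeomorphism
  there. As \<open>k\<close> varies these intervals are mapped to one another by \<open>f\<close>, and the inverse
  homeomorphisms are the coordinates of a continuous section over \<open>{p N..q N}\<close> passing through \<open>x\<close>
  (\<open>section_between\<close>).

  Such a section is an arc with \<open>x\<close> inside, so \<open>x\<close> is not an L-endpoint. If \<open>x\<close> were an endpoint of
  some \<open>N\<close>-basic arc, that arc would project to one side of \<open>x N\<close> and could be prolonged by the other
  half of the section, against maximality; so \<open>x\<close> is not a B-endpoint either.

  Of the remaining inclusions, an endpoint is an L-endpoint because an interior point of an arc
  lies in two subarcs that are not nested. An L-endpoint is a B-endpoint because basic arcs exist,
  by Zorn's lemma: the closure of a connected set with injective \<open>i\<close>-th coordinate again has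
  injective \<open>i\<close>-th coordinate (\<open>coord_closure_inj\<close>), hence is an arc or a point.
\<close>

section \<open>Real functions on intervals\<close>

text \<open>
  Equal values at the ends would make \<open>h\<close> take every value between \<open>h a\<close> and the value at an inner
  point on both sides of that point.
\<close>

lemma interior_injective_imp_ends_differ:
  fixes h :: "real \<Rightarrow> real"
  assumes "a < b" and cont: "continuous_on {a..b} h" and inj: "inj_on h {a<..<b}"
  shows "h a \<noteq> h b"
proof
  assume eq: "h a = h b"
  define c where "c = (a + b) / 2"
  have c: "a < c" "c < b" using \<open>a < b\<close> by (auto simp: c_def)
  have cont1: "continuous_on {a..c} h" and cont2: "continuous_on {c..b} h"
    using cont c by (auto intro: continuous_on_subset)
  have twice: False if v: "h a \<noteq> v" "h c \<noteq> v" "s \<in> {a..c}" "h s = v" "t \<in> {c..b}" "h t = v" for v s t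
  proof -
    have "s \<noteq> a" "s \<noteq> c" "t \<noteq> b" "t \<noteq> c" using v eq by auto
    then have "s \<in> {a<..<b}" "t \<in> {a<..<b}" "s \<noteq> t" using v c by auto
    with inj v show False by (metis inj_onD)
  qed
  define v where "v = (h a + h c) / 2"
  consider "h a < h c" | "h c < h a" | "h a = h c" by linarith
  then show False
  proof cases
    case 1
    then have "h a < v" "v < h c" by (auto simp: v_def)
    with IVT'[of h a v c] IVT2'[of h b v c] cont1 cont2 c eq twice[of v]
    show False by (smt (verit) atLeastAtMost_iff)
  next
    case 2
    then have "h c < v" "v < h a" by (auto simp: v_def)
    with IVT'[of h c v b] IVT2'[of h c v a] cont1 cont2 c eq twice[of v]
    show False by (smt (verit) atLeastAtMost_iff)
  next
    case 3
    \<comment> \<open>If the midpoint happens to carry the end value, the same argument applies to the left half.\<close>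
    define d where "d = (a + c) / 2"
    have d: "a < d" "d < c" using c by (auto simp: d_def)
    have hd: "h d \<noteq> h c"
      using inj c d by (auto dest: inj_onD[of h _ d c])
    define w where "w = (h a + h d) / 2"
    have cad: "continuous_on {a..d} h" and cdc: "continuous_on {d..c} h"
      using cont1 d by (auto intro: continuous_on_subset)
    have "\<exists>s. a \<le> s \<and> s \<le> d \<and> h s = w"
      using IVT'[of h a w d] IVT2'[of h d w a] cad d by (cases "h a \<le> h d") (auto simp: w_def)
    moreover have "\<exists>t. d \<le> t \<and> t \<le> c \<and> h t = w"
      using IVT'[of h d w c] IVT2'[of h c w d] cdc d 3 by (cases "h a \<le> h d") (auto simp: w_def)
    ultimately obtain s t where st: "a \<le> s" "s \<le> d" "h s = w" "d \<le> t" "t \<le> c" "h t = w"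
      by blast
    have "w \<noteq> h a" "w \<noteq> h d" using hd 3 by (auto simp: w_def)
    then have "s \<noteq> a" "s \<noteq> d" "t \<noteq> d" using st by auto
    then have "s \<in> {a<..<b}" "t \<in> {a<..<b}" "s \<noteq> t" using st c d by auto
    with inj st show False by (metis inj_onD)
  qed
qed

lemma last_crossing:
  fixes h :: "real \<Rightarrow> real"
  assumes "c \<le> z" and cont: "continuous_on {c..z} h" and "h c = l" and "l < h z"
  obtains a where "c \<le> a" "a < z" "h a = l" "\<And>t. a < t \<Longrightarrow> t \<le> z \<Longrightarrow> l < h t"
proof -
  let ?S = "{t \<in> {c..z}. h t = l}"
  have "closed ?S"
    using continuous_closed_preimage_constant[OF cont, of l] by simp
  then have "compact ?S"
    using compact_Int_closed[of "{c..z}" ?S] by (simp add: Int_def conj_ac)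
  moreover have "c \<in> ?S" using assms by auto
  ultimately obtain a where a: "a \<in> ?S" and max: "\<And>t. t \<in> ?S \<Longrightarrow> t \<le> a"
    using compact_attains_sup[of ?S] by blast
  have "l < h t" if t: "a < t" "t \<le> z" for t
  proof (rule ccontr)
    assume "\<not> l < h t"
    moreover have "continuous_on {t..z} h"
      using cont a t by (auto intro: continuous_on_subset)
    ultimately obtain s where "t \<le> s" "s \<le> z" "h s = l"
      using IVT'[of h t l z] t \<open>l < h z\<close> by auto
    with max[of s] a t show False by auto
  qed
  with that[of a] a \<open>l < h z\<close> show thesis by fastforce
qed

lemma clean_window_increasing:
  fixes h :: "real \<Rightarrow> real"
  assumes "c < z" "z < d" and cont: "continuous_on {c..d} h" and "h c = l" "h d = u"
    and left: "\<And>t. t \<in> {c..z} \<Longrightarrow> h t < u" and right: "\<And>t. t \<in> {z..d} \<Longrightarrow> l < h t"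
  shows "\<exists>a b. c \<le> a \<and> a < z \<and> z < b \<and> b \<le> d \<and> h a = l \<and> h b = u \<and>
               (\<forall>t\<in>{a<..<b}. l < h t \<and> h t < u)"
proof -
  have z: "l < h z" "h z < u" using left[of z] right[of z] assms by auto
  have "continuous_on {c..z} h" using cont assms by (auto intro: continuous_on_subset)
  then obtain a where a: "c \<le> a" "a < z" "h a = l" "\<And>t. a < t \<Longrightarrow> t \<le> z \<Longrightarrow> l < h t"
    using last_crossing[of c z h l] assms z by auto
  have "continuous_on {-d..-z} (\<lambda>t. - h (- t))"
    using assms by (intro continuous_intros continuous_on_compose2[OF cont]) auto
  then obtain b where b: "-d \<le> b" "b < -z" "- h (-b) = -u"
      "\<And>t. b < t \<Longrightarrow> t \<le> -z \<Longrightarrow> -u < - h (-t)"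
    using last_crossing[of "-d" "-z" "\<lambda>t. - h (- t)" "-u"] assms z by auto
  have "l < h t \<and> h t < u" if "t \<in> {a<..<-b}" for t
    using a(4)[of t] b(4)[of "-t"] left[of t] right[of t] that a(1) b(1) by (cases "t \<le> z") auto
  with a b show ?thesis by (intro exI[of _ a] exI[of _ "-b"]) auto
qed

text \<open>
  The form in which the zigzag argument needs \<open>last_crossing\<close>: \<open>P\<close> and \<open>Q\<close> will be projections of two
  subcontinua containing the point, and \<open>h\<close> an iterate of the map. Since \<open>h\<close> omits \<open>u\<close> on \<open>P\<close> and \<open>l\<close>
  on \<open>Q\<close>, the points \<open>c\<close> and \<open>d\<close> lie outside the other set, and therefore on different sides of \<open>z\<close>;
  which side belongs to which is not determined.
\<close>

lemma clean_window:
  fixes h :: "real \<Rightarrow> real"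
  assumes cont: "continuous_on S h" and S: "connected S"
    and P: "connected P" "P \<subseteq> S" and Q: "connected Q" "Q \<subseteq> S"
    and c: "c \<in> P" "h c = l" and d: "d \<in> Q" "h d = u" and z: "z \<in> P" "z \<in> Q"
    and less: "\<And>t. t \<in> P \<Longrightarrow> h t < u" and gr: "\<And>t. t \<in> Q \<Longrightarrow> l < h t"
  shows "\<exists>a\<in>S. \<exists>b\<in>S. a < z \<and> z < b \<and> (h a = l \<and> h b = u \<or> h a = u \<and> h b = l) \<and>
               (\<forall>t\<in>{a<..<b}. l < h t \<and> h t < u)"
proof -
  have "c \<notin> Q" "d \<notin> P" using less gr c d by fastforce+
  then have "c \<noteq> z" "d \<noteq> z" using z by auto
  have P_Icc: "{s..t} \<subseteq> P" if "s \<in> P" "t \<in> P" for s t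
    using that P connected_contains_Icc by blast
  have Q_Icc: "{s..t} \<subseteq> Q" if "s \<in> Q" "t \<in> Q" for s t
    using that Q connected_contains_Icc by blast
  have S_Icc: "{s..t} \<subseteq> S" if "s \<in> S" "t \<in> S" for s t
    using that S connected_contains_Icc by blast
  have cS: "c \<in> S" and dS: "d \<in> S" using c d P Q by auto
  show ?thesis
  proof (cases "c < z")
    case True
    have "z < d"
    proof (rule ccontr)
      assume "\<not> z < d"
      then have "c \<in> {d..z} \<or> d \<in> {c..z}" using True by auto
      then show False using P_Icc[OF c(1) z(1)] Q_Icc[OF d(1) z(2)] \<open>c \<notin> Q\<close> \<open>d \<notin> P\<close> by blast
    qed
    then obtain a b where "c \<le> a" "a < z" "z < b" "b \<le> d" "h a = l" "h b = u"
        "\<forall>t\<in>{a<..<b}. l < h t \<and> h t < u"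
      using clean_window_increasing[of c z d h l u] True c d less gr P_Icc[OF c(1) z(1)]
        Q_Icc[OF z(2) d(1)] continuous_on_subset[OF cont S_Icc[OF cS dS]] by blast
    moreover from this have "a \<in> S" "b \<in> S" using S_Icc[OF cS dS] by auto
    ultimately show ?thesis by blast
  next
    case False
    then have "z < c" using \<open>c \<noteq> z\<close> by auto
    have "d < z"
    proof (rule ccontr)
      assume "\<not> d < z"
      then have "c \<in> {z..d} \<or> d \<in> {z..c}" using \<open>z < c\<close> by auto
      then show False using P_Icc[OF z(1) c(1)] Q_Icc[OF z(2) d(1)] \<open>c \<notin> Q\<close> \<open>d \<notin> P\<close> by blast
    qed
    \<comment> \<open>Passing to the negative of the function exchanges the roles of the two levels.\<close>
    have "\<exists>a b. d \<le> a \<and> a < z \<and> z < b \<and> b \<le> c \<and> - h a = -u \<and> - h b = -l \<and>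
               (\<forall>t\<in>{a<..<b}. -u < - h t \<and> - h t < -l)"
      using \<open>d < z\<close> \<open>z < c\<close> c d less gr P_Icc[OF z(1) c(1)] Q_Icc[OF d(1) z(2)]
        continuous_on_subset[OF cont S_Icc[OF dS cS]]
      by (intro clean_window_increasing continuous_intros) auto
    then obtain a b where "d \<le> a" "a < z" "z < b" "b \<le> c" "h a = u" "h b = l"
        "\<forall>t\<in>{a<..<b}. l < h t \<and> h t < u" by auto
    moreover from this have "a \<in> S" "b \<in> S" using S_Icc[OF dS cS] by auto
    ultimately show ?thesis by blast
  qed
qed

section \<open>Arcs and injective projections\<close>

text \<open>
  The image is a compact interval, and an injective continuous map on a compact space is a
  homeomorphism onto its image; the inverse, rescaled to \<open>{0..1}\<close>, parametrizes the arc. This turns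
  basic arcs into mere subcontinua on which a coordinate is injective.
\<close>

lemma arc_or_point_if_injective_real_map:
  fixes C :: "'a::t2_space set" and h :: "'a \<Rightarrow> real"
  assumes "compact C" "connected C" "C \<noteq> {}" and cont: "continuous_on C h" and inj: "inj_on h C"
  shows "arc_or_point C"
proof -
  obtain l u where lu: "h ` C = {l..u}"
    using connected_compact_interval_1 compact_continuous_image connected_continuous_image assms
    by metis
  have "l \<le> u" using lu \<open>C \<noteq> {}\<close> by (metis atLeastatMost_empty_iff image_is_empty)
  show ?thesis
  proof (cases "l = u")
    case True
    then have "h ` C = {l}" using lu by simp
    obtain y where "y \<in> C" using \<open>C \<noteq> {}\<close> by auto
    have "z = y" if "z \<in> C" for z
    proof -
      have "h z \<in> {l}" "h y \<in> {l}" using \<open>h ` C = {l}\<close> that \<open>y \<in> C\<close> by blast+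
      then show ?thesis using inj that \<open>y \<in> C\<close> by (auto dest: inj_onD)
    qed
    with \<open>y \<in> C\<close> have "\<exists>y. C = {y}" by blast
    then show ?thesis by (simp add: arc_or_point_def)
  next
    case False
    with \<open>l \<le> u\<close> have "l < u" by simp
    obtain k where k: "homeomorphism C {l..u} h k"
      using homeomorphism_compact[of C h "{l..u}"] assms lu by metis
    define g where "g = k \<circ> (\<lambda>t. l + t * (u - l))"
    have img: "(\<lambda>t. l + t * (u - l)) ` {0..1} = {l..u}"
    proof (intro equalityI subsetI)
      fix s assume "s \<in> {l..u}"
      then have "s = l + ((s - l) / (u - l)) * (u - l)" "(s - l) / (u - l) \<in> {0..1}"
        using \<open>l < u\<close> by (auto simp: field_simps)
      then show "s \<in> (\<lambda>t. l + t * (u - l)) ` {0..1}" by blast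
    next
      fix s assume "s \<in> (\<lambda>t. l + t * (u - l)) ` {0..1}"
      then obtain t where t: "0 \<le> t" "t \<le> 1" "s = l + t * (u - l)" by auto
      then have "0 \<le> t * (u - l)" "t * (u - l) \<le> 1 * (u - l)"
        using \<open>l < u\<close> by (auto intro!: mult_right_mono)
      then show "s \<in> {l..u}" using t by auto
    qed
    have "continuous_on {0..1} g"
      unfolding g_def using homeomorphism_cont2[OF k] img
      by (intro continuous_on_compose) (auto intro!: continuous_intros)
    moreover have "inj_on g {0..1}"
      unfolding g_def
    proof (rule comp_inj_on)
      show "inj_on (\<lambda>t. l + t * (u - l)) {0..1}" using \<open>l < u\<close> by (auto simp: inj_on_def)
      show "inj_on k ((\<lambda>t. l + t * (u - l)) ` {0..1})"
        unfolding img using homeomorphism_apply2[OF k] by (metis inj_onI)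
    qed
    moreover have "g ` {0..1} = C"
      unfolding g_def image_comp[symmetric] img using homeomorphism_image2[OF k] .
    ultimately show ?thesis
      unfolding arc_or_point_def nondegenerate_arc_def arc_def path_def path_image_def by blast
  qed
qed

lemma arc_or_point_imp_continuum:
  fixes C :: "'a::topological_space set"
  assumes "arc_or_point C"
  shows "compact C" "connected C" "C \<noteq> {}"
  using assms unfolding arc_or_point_def nondegenerate_arc_def
  by (auto simp: compact_arc_image connected_arc_image)

text \<open>
  Removing an endpoint leaves an arc connected, and hence leaves its image in the line connected.
\<close>

lemma arc_endpoint_extreme:
  fixes h :: "'a::topological_space \<Rightarrow> real"
  assumes "arc_endpoint A x" and cont: "continuous_on A h" and inj: "inj_on h A"
  shows "(\<forall>y\<in>A. h x \<le> h y) \<or> (\<forall>y\<in>A. h y \<le> h x)"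
proof (cases "A = {x}")
  case False
  then obtain g where g: "arc g" "path_image g = A" "x = g 0 \<or> x = g 1"
    using assms unfolding arc_endpoint_def pathstart_def pathfinish_def by blast
  have gcont: "continuous_on {0..1} g" and ginj: "inj_on g {0..1}" and gimg: "g ` {0..1} = A"
    using g unfolding arc_def path_def path_image_def by auto
  have "x \<in> A" using g(3) gimg by auto
  have hit: "t = 0 \<or> t = 1" if "t \<in> {0..1}" "g t = x" for t
    using g(3) ginj that by (auto dest: inj_onD)
  have "connected (A - {x})"
  proof -
    have Icc0: "{0..1::real} - {0} = {0<..1}" and Icc1: "{0..1::real} - {1} = {0..<1}"
      by auto
    obtain J where J: "connected J" "g ` J = A - {x}" "J \<subseteq> {0..1}"
    proof (cases "x = g 0")
      case True
      have "g ` {0<..1} = A - {x}"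
        using inj_on_image_set_diff[OF ginj Diff_subset, of "{0}"] gimg True by (simp add: Icc0)
      then show thesis by (intro that[of "{0<..1}"]) auto
    next
      case False
      then have "x = g 1" using g by simp
      then have "g ` {0..<1} = A - {x}"
        using inj_on_image_set_diff[OF ginj Diff_subset, of "{1}"] gimg by (simp add: Icc1)
      then show thesis by (intro that[of "{0..<1}"]) auto
    qed
    then show ?thesis
      using connected_continuous_image[of J g] continuous_on_subset[OF gcont] by metis
  qed
  then have conn: "connected (h ` (A - {x}))"
    by (intro connected_continuous_image continuous_on_subset[OF cont]) auto
  show ?thesis
  proof (rule ccontr)
    assume "\<not> ?thesis"
    then obtain y y' where y: "y \<in> A" "h y < h x" and y': "y' \<in> A" "h x < h y'"
      by (auto simp: not_le)
    then have "h y \<in> h ` (A - {x})" "h y' \<in> h ` (A - {x})" by auto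
    then have "h x \<in> h ` (A - {x})"
      using connectedD_interval[OF conn] y y' by (meson less_imp_le)
    then show False using inj \<open>x \<in> A\<close> by (auto dest: inj_onD)
  qed
qed auto

lemma endpoints_subset_L_endpoints: "endpoints X \<subseteq> L_endpoints X"
proof
  fix x assume x: "x \<in> endpoints X"
  then have "x \<in> X" and nested: "\<And>A B. subcontinuum X A \<Longrightarrow> subcontinuum X B \<Longrightarrow>
      x \<in> A \<Longrightarrow> x \<in> B \<Longrightarrow> A \<subseteq> B \<or> B \<subseteq> A"
    unfolding endpoints_def by auto
  have "arc_endpoint A x" if A: "nondegenerate_arc A" "A \<subseteq> X" "x \<in> A" for A
  proof -
    obtain g where g: "arc g" "path_image g = A" using A unfolding nondegenerate_arc_def by blast
    then have gcont: "continuous_on {0..1} g" and ginj: "inj_on g {0..1}" and gimg: "g ` {0..1} = A"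
      unfolding arc_def path_def path_image_def by auto
    then obtain t where t: "t \<in> {0..1}" "x = g t" using A by auto
    have sub: "subcontinuum X (g ` {a..b})" if "0 \<le> a" "a \<le> b" "b \<le> 1" for a b
    proof -
      have "continuous_on {a..b} g" using gcont that by (auto intro: continuous_on_subset)
      moreover have "g ` {a..b} \<subseteq> A" using gimg that by auto
      ultimately show ?thesis
        using that A unfolding subcontinuum_def
        by (auto intro: compact_continuous_image connected_continuous_image)
    qed
    have "g ` {0..t} \<subseteq> g ` {t..1} \<or> g ` {t..1} \<subseteq> g ` {0..t}"
      using t by (intro nested sub) auto
    then have "{0..t} \<subseteq> {t..1} \<or> {t..1} \<subseteq> {0..t}"
      using inj_on_image_subset_iff[OF ginj, of "{0..t}" "{t..1}"]
        inj_on_image_subset_iff[OF ginj, of "{t..1}" "{0..t}"] t by auto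
    then have "t = 0 \<or> t = 1" using t by auto
    then show ?thesis
      using g t unfolding arc_endpoint_def pathstart_def pathfinish_def by blast
  qed
  with \<open>x \<in> X\<close> show "x \<in> L_endpoints X" unfolding L_endpoints_def by blast
qed


section \<open>Inverse limits of interval surjections\<close>

locale interval_surjection =
  fixes f :: "real \<Rightarrow> real"
  assumes cont: "continuous_on {0..1} f" and surj: "f ` {0..1} = {0..1}"
begin

abbreviation X where "X \<equiv> inverse_limit f"

lemma iterate_surj: "(f ^^ n) ` {0..1} = {0..1}"
  by (induction n) (simp_all add: image_comp[symmetric] surj del: comp_apply)

lemma iterate_mem: "t \<in> {0..1} \<Longrightarrow> (f ^^ n) t \<in> {0..1}"
  using iterate_surj by blast

lemma iterate_cont: "continuous_on {0..1} (f ^^ n)"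
proof (induction n)
  case (Suc n)
  then show ?case
    using continuous_on_compose[of "{0..1}" "f ^^ n" f] cont by (simp add: iterate_surj)
qed (simp add: continuous_on_id[unfolded id_def] id_def)

lemma coord_mem: "x \<in> X \<Longrightarrow> x i \<in> {0..1}"
  by (simp add: inverse_limit_def)

lemma iterate_coord: "x \<in> X \<Longrightarrow> (f ^^ k) (x (n + k)) = x n"
proof (induction k)
  case (Suc k)
  then have "f (x (n + Suc k)) = x (n + k)"
    by (auto simp: inverse_limit_def dest: spec[of _ "n + Suc k"])
  with Suc show ?case by (simp only: funpow_Suc_right comp_apply)
qed simp

lemma coord_eq_below: "x \<in> X \<Longrightarrow> y \<in> X \<Longrightarrow> x n = y n \<Longrightarrow> m \<le> n \<Longrightarrow> x m = y m"
  by (metis iterate_coord le_add_diff_inverse)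

lemma coord_cont: "continuous_on S (\<lambda>y :: nat \<Rightarrow> real. y i)"
  by (rule continuous_on_subset[OF continuous_on_product_coordinates]) simp

lemma compact_X: "compact X"
proof -
  have "compact (PiE UNIV (\<lambda>_::nat. {0..1::real}))"
    using compactin_PiE[of "\<lambda>_::nat. euclidean::real topology" UNIV "\<lambda>_. {0..1}"]
    by (simp add: euclidean_product_topology)
  moreover have "closed X"
  proof -
    \<comment> \<open>Clamping to the unit interval extends the map continuously to the whole line.\<close>
    define F where "F t = f (max 0 (min 1 t))" for t
    have F_cont: "continuous_on UNIV F"
      unfolding F_def
      by (rule continuous_on_compose2[OF cont]) (auto intro!: continuous_intros)
    have F_eq: "F t = f t" if "t \<in> {0..1}" for t
      using that by (simp add: F_def)
    have "X = (\<Inter>i. (\<lambda>x. x i) -` {0..1}) \<inter> (\<Inter>i\<in>{1..}. {x. F (x i) = x (i - 1)})"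
      by (auto simp: inverse_limit_def F_eq)
    moreover have "closed ((\<lambda>x :: nat \<Rightarrow> real. x i) -` {0..1})" for i
      by (rule closed_vimage[OF closed_atLeastAtMost coord_cont])
    moreover have "closed {x :: nat \<Rightarrow> real. F (x i) = x (i - 1)}" for i
      by (rule closed_Collect_eq[OF continuous_on_compose2[OF F_cont coord_cont subset_UNIV] coord_cont])
    ultimately show ?thesis by (auto intro!: closed_Int closed_INT)
  qed
  ultimately have "compact (PiE UNIV (\<lambda>_::nat. {0..1::real}) \<inter> X)"
    by (rule compact_Int_closed)
  moreover have "PiE UNIV (\<lambda>_::nat. {0..1::real}) \<inter> X = X"
    using coord_mem by blast
  ultimately show ?thesis by simp
qed

text \<open>
  Points of \<open>B\<close> that agree with \<open>p\<close> in coordinate \<open>N\<close> agree with it in all earlier ones, so if there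
  were such points for unboundedly many \<open>N\<close>, they would converge to \<open>p\<close>.
\<close>

lemma coord_eventually_outside:
  assumes "closed B" "B \<subseteq> X" "p \<in> X" "p \<notin> B"
  obtains N where "\<And>n y. N \<le> n \<Longrightarrow> y \<in> B \<Longrightarrow> y n \<noteq> p n"
proof (rule ccontr)
  assume "\<not> thesis"
  then have "\<exists>y\<in>B. \<forall>m\<le>N. y m = p m" for N
    using that[of N] coord_eq_below assms(2,3) by (meson order_trans subset_iff)
  then obtain s where s: "\<And>N. s N \<in> B" "\<And>N m. m \<le> N \<Longrightarrow> s N m = p m" by metis
  have "(\<lambda>N. s N m) \<longlonglongrightarrow> p m" for m
    using s(2) by (intro tendsto_eventually) (auto simp: eventually_sequentially)
  then have "s \<longlonglongrightarrow> p"
    using limitin_componentwise[of "\<lambda>_::nat. euclidean::real topology" UNIV s p sequentially]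
    by (simp add: euclidean_product_topology)
  with \<open>closed B\<close> s(1) have "p \<in> B"
    by (metis closed_sequentially)
  with \<open>p \<notin> B\<close> show False ..
qed

section \<open>Existence of basic arcs\<close>

text \<open>
  This is what makes unions of chains of candidates for a basic arc manageable. Two points of the
  closure that agree in coordinate \<open>i\<close> but differ in a later coordinate \<open>n\<close> would span an interval
  whose interior is contained in the projection of \<open>U\<close>. There \<open>f ^^ (n - i)\<close> is injective, so it
  separates the ends of the interval, whereas both are mapped to the common \<open>i\<close>-th coordinate.
\<close>

lemma coord_closure_inj:
  assumes U: "U \<subseteq> X" "connected U" and inj: "inj_on (\<lambda>y. y i) U"
  shows "inj_on (\<lambda>y. y i) (closure U)"
proof (rule inj_onI)
  have "closure U \<subseteq> X"
    using U compact_X compact_imp_closed closure_minimal by blast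
  have no: "\<not> y n < z n" if "i \<le> n" "y \<in> closure U" "z \<in> closure U" "y i = z i" for y z n
  proof
    assume less: "y n < z n"
    let ?J = "(\<lambda>y. y n) ` U"
    have "(\<lambda>y. y n) ` closure U \<subseteq> closure ?J"
      by (intro image_closure_subset coord_cont closed_closure closure_subset)
    then have cl: "y n \<in> closure ?J" "z n \<in> closure ?J" using that by auto
    have "connected ?J" using U coord_cont connected_continuous_image by blast
    have sub: "{y n<..<z n} \<subseteq> ?J"
    proof
      fix t assume t: "t \<in> {y n<..<z n}"
      have "\<exists>s\<in>?J. s \<in> {..<t}" "\<exists>s\<in>?J. s \<in> {t<..}"
        using t closure_iff_nhds_not_empty[of "y n" ?J] closure_iff_nhds_not_empty[of "z n" ?J] cl
        by (metis disjoint_iff greaterThanLessThan_iff lessThan_iff open_lessThan order_refl,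
            metis disjoint_iff greaterThanLessThan_iff greaterThan_iff open_greaterThan order_refl)
      with \<open>connected ?J\<close> show "t \<in> ?J"
        using connectedD_interval[of ?J] by (metis greaterThan_iff lessThan_iff less_imp_le)
    qed
    have it: "(f ^^ (n - i)) (v n) = v i" if "v \<in> X" for v
      using iterate_coord[OF that, of "n - i" i] \<open>i \<le> n\<close> by simp
    have "inj_on (f ^^ (n - i)) ?J"
    proof (rule inj_onI; clarify)
      fix v w assume "v \<in> U" "w \<in> U" "(f ^^ (n - i)) (v n) = (f ^^ (n - i)) (w n)"
      then show "v n = w n" using it U inj by (metis inj_onD subset_iff)
    qed
    then have "inj_on (f ^^ (n - i)) {y n<..<z n}" using sub inj_on_subset by blast
    moreover have "y n \<in> {0..1}" "z n \<in> {0..1}"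
      using that \<open>closure U \<subseteq> X\<close> coord_mem by blast+
    then have "continuous_on {y n..z n} (f ^^ (n - i))"
      by (intro continuous_on_subset[OF iterate_cont]) auto
    ultimately have "(f ^^ (n - i)) (y n) \<noteq> (f ^^ (n - i)) (z n)"
      using interior_injective_imp_ends_differ less by blast
    then show False using it that \<open>closure U \<subseteq> X\<close> by (simp add: subset_iff)
  qed
  fix y z assume yz: "y \<in> closure U" "z \<in> closure U" "y i = z i"
  show "y = z"
  proof
    fix n
    show "y n = z n"
    proof (cases "i \<le> n")
      case True
      then show ?thesis using no[of n y z] no[of n z y] yz by auto
    next
      case False
      then show ?thesis using coord_eq_below[of y z i n] yz \<open>closure U \<subseteq> X\<close> by auto
    qed
  qed
qed

lemma basic_arc_exists:
  assumes "x \<in> X"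
  shows "\<exists>A. is_basic_arc X i x A"
proof -
  let ?cand = "{C. arc_or_point C \<and> C \<subseteq> X \<and> x \<in> C \<and> inj_on (\<lambda>y. y i) C}"
  have "\<exists>M\<in>?cand. \<forall>C\<in>?cand. M \<subseteq> C \<longrightarrow> C = M"
  proof (rule subset_Zorn)
    fix \<C> assume ch: "subset.chain ?cand \<C>"
    show "\<exists>U\<in>?cand. \<forall>C\<in>\<C>. C \<subseteq> U"
    proof (cases "\<C> = {}")
      case True
      have "{x} \<in> ?cand" using assms by (simp add: arc_or_point_def)
      with True show ?thesis by blast
    next
      case False
      let ?U = "\<Union>\<C>"
      have mem: "arc_or_point C" "C \<subseteq> X" "x \<in> C" "inj_on (\<lambda>y. y i) C" if "C \<in> \<C>" for C
        using ch that unfolding subset.chain_def by blast+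
      have conn: "connected ?U"
        using mem arc_or_point_imp_continuum by (intro connected_Union) blast+
      have "inj_on (\<lambda>y. y i) ?U"
      proof (rule inj_onI; clarify)
        fix y z C D assume yz: "y \<in> C" "z \<in> D" "y i = z i" and CD: "C \<in> \<C>" "D \<in> \<C>"
        then have "C \<subseteq> D \<or> D \<subseteq> C" using ch unfolding subset.chain_def by blast
        then show "y = z" using yz mem(4)[OF CD(1)] mem(4)[OF CD(2)] by (meson inj_onD subsetD)
      qed
      then have inj: "inj_on (\<lambda>y. y i) (closure ?U)"
        using conn mem(2) by (intro coord_closure_inj) auto
      have "closure ?U \<subseteq> X"
        by (rule closure_minimal[OF _ compact_imp_closed[OF compact_X]]) (use mem(2) in blast)
      then have "compact (closure ?U)"
        using compact_Int_closed[OF compact_X, of "closure ?U"] by (simp add: Int_absorb1)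
      moreover have "x \<in> closure ?U"
        using False mem(3) closure_subset[of ?U] by blast
      moreover from this have "closure ?U \<noteq> {}" by (metis empty_iff)
      moreover have "connected (closure ?U)"
        by (rule connected_imp_connected_closure[OF conn])
      ultimately have "arc_or_point (closure ?U)"
        using inj by (intro arc_or_point_if_injective_real_map[OF _ _ _ coord_cont]) blast+
      with inj \<open>closure ?U \<subseteq> X\<close> \<open>x \<in> closure ?U\<close> have "closure ?U \<in> ?cand" by simp
      moreover have "\<forall>C\<in>\<C>. C \<subseteq> closure ?U" using closure_subset[of ?U] by blast
      ultimately show ?thesis by (rule bexI[rotated])
    qed
  qed
  then obtain M where "M \<in> ?cand" "\<forall>C\<in>?cand. M \<subseteq> C \<longrightarrow> C = M" by blast
  then have "is_basic_arc X i x M" unfolding is_basic_arc_def Let_def by blast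
  then show ?thesis ..
qed

lemma L_endpoints_subset_B_endpoints: "L_endpoints X \<subseteq> B_endpoints X"
proof
  fix x assume x: "x \<in> L_endpoints X"
  then have "x \<in> X" unfolding L_endpoints_def by auto
  have "\<exists>A. is_basic_arc X i x A \<and> arc_endpoint A x" for i
  proof -
    obtain A where A: "is_basic_arc X i x A" using basic_arc_exists[OF \<open>x \<in> X\<close>] by blast
    then have "arc_or_point A" "A \<subseteq> X" "x \<in> A" unfolding is_basic_arc_def Let_def by auto
    then have "arc_endpoint A x"
      using x unfolding L_endpoints_def arc_or_point_def arc_endpoint_def by blast
    with A show ?thesis by blast
  qed
  with \<open>x \<in> X\<close> show "x \<in> B_endpoints X" unfolding B_endpoints_def by blast
qed


section \<open>Projections of proper subcontinua\<close>

text \<open>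
  Cut \<open>{0..1}\<close> into \<open>s\<close> equal cells of length less than \<open>\<delta> / 2\<close>: every interval of length at least
  \<open>\<delta>\<close> contains a cell, and only finitely many exponents, one for each cell, have to be dominated.
\<close>

lemma leo_uniform:
  assumes leo: "locally_eventually_onto f" and "\<delta> > 0"
  obtains m where "\<And>a b. 0 \<le> a \<Longrightarrow> b \<le> 1 \<Longrightarrow> a + \<delta> \<le> b \<Longrightarrow> (f ^^ m) ` {a..b} = {0..1}"
proof -
  obtain s :: nat where s: "2 / \<delta> < real s" using reals_Archimedean2 by blast
  have "0 < 2 / \<delta>" using \<open>\<delta> > 0\<close> by simp
  then have "0 < real s" using s by linarith
  have "2 / real s < \<delta>" using s \<open>0 < real s\<close> \<open>\<delta> > 0\<close> by (simp add: field_simps)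
  define cell where "cell j = {real j / real s..(real j + 1) / real s}" for j :: nat
  have "\<exists>n. (f ^^ n) ` cell j = {0..1}" if "j < s" for j
  proof -
    have "real j + 1 \<le> real s" using that by linarith
    then have "0 \<le> real j / real s" "real j / real s < (real j + 1) / real s"
        "(real j + 1) / real s \<le> 1"
      using \<open>0 < real s\<close> by (auto simp: divide_simps)
    then show ?thesis using leo unfolding locally_eventually_onto_def cell_def by blast
  qed
  then obtain n where n: "\<And>j. j < s \<Longrightarrow> (f ^^ n j) ` cell j = {0..1}" by metis
  \<comment> \<open>Any common upper bound would do, since further iterates keep the image equal to the whole interval.\<close>
  define m where "m = (\<Sum>j<s. n j)"
  have "(f ^^ m) ` {a..b} = {0..1}" if ab: "0 \<le> a" "b \<le> 1" "a + \<delta> \<le> b" for a b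
  proof -
    define j where "j = nat \<lceil>a * real s\<rceil>"
    have j: "a * real s \<le> real j" "real j < a * real s + 1"
      using ab \<open>0 < real s\<close> unfolding j_def by (simp_all add: real_nat_ceiling_ge) linarith
    have "a \<le> real j / real s" using j \<open>0 < real s\<close> by (simp add: field_simps)
    have "(real j + 1) / real s \<le> (a * real s + 2) / real s"
      using j \<open>0 < real s\<close> by (intro divide_right_mono) auto
    also have "\<dots> = a + 2 / real s" using \<open>0 < real s\<close> by (simp add: field_simps)
    also have "\<dots> < b" using \<open>2 / real s < \<delta>\<close> ab by linarith
    finally have "(real j + 1) / real s < b" .
    then have "(real j + 1) / real s < 1" using ab by simp
    then have "j < s" using \<open>0 < real s\<close> by (simp add: field_simps)
    have "n j \<le> m" unfolding m_def using \<open>j < s\<close> by (intro member_le_sum) auto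
    then have split: "f ^^ m = f ^^ (m - n j) \<circ> f ^^ n j" by (simp flip: funpow_add)
    have "cell j \<subseteq> {a..b}"
      using \<open>a \<le> real j / real s\<close> \<open>(real j + 1) / real s < b\<close> unfolding cell_def by auto
    have "{0..1} = (f ^^ (m - n j)) ` (f ^^ n j) ` cell j"
      using n[OF \<open>j < s\<close>] iterate_surj by simp
    also have "\<dots> = (f ^^ m) ` cell j" unfolding split by (simp add: image_comp)
    also have "\<dots> \<subseteq> (f ^^ m) ` {a..b}" using \<open>cell j \<subseteq> {a..b}\<close> by blast
    finally have "{0..1} \<subseteq> (f ^^ m) ` {a..b}" .
    moreover have "(f ^^ m) ` {a..b} \<subseteq> {0..1}"
      using iterate_mem ab by (intro image_subsetI) auto
    ultimately show ?thesis by blast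
  qed
  then show thesis using that by blast
qed

text \<open>
  A long projection to coordinate \<open>K + i + m\<close> would be spread over all of \<open>{0..1}\<close> by \<open>f ^^ m\<close>, so the
  projection to coordinate \<open>K + i\<close> would contain that of \<open>p\<close>.
\<close>

lemma proper_subcontinuum_coords_shrink:
  assumes leo: "locally_eventually_onto f" and C: "subcontinuum X C"
    and p: "p \<in> X" "p \<notin> C" and "\<delta> > 0"
  obtains M where "\<And>n y z. M \<le> n \<Longrightarrow> y \<in> C \<Longrightarrow> z \<in> C \<Longrightarrow> \<bar>y n - z n\<bar> < \<delta>"
proof -
  have sub: "C \<subseteq> X" and "closed C" and "connected C"
    using C compact_imp_closed unfolding subcontinuum_def by auto
  obtain K where K: "\<And>n y. K \<le> n \<Longrightarrow> y \<in> C \<Longrightarrow> y n \<noteq> p n"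
    using coord_eventually_outside \<open>closed C\<close> sub p by metis
  obtain m where m: "\<And>a b. 0 \<le> a \<Longrightarrow> b \<le> 1 \<Longrightarrow> a + \<delta> \<le> b \<Longrightarrow> (f ^^ m) ` {a..b} = {0..1}"
    using leo_uniform[OF leo \<open>\<delta> > 0\<close>] by metis
  have short: "z (K + i + m) < y (K + i + m) + \<delta>" if "y \<in> C" "z \<in> C" for i y z
  proof (rule ccontr)
    let ?n = "K + i + m"
    assume "\<not> ?thesis"
    moreover have "y ?n \<in> {0..1}" "z ?n \<in> {0..1}" using coord_mem sub that by blast+
    ultimately have "(f ^^ m) ` {y ?n..z ?n} = {0..1}" by (intro m) auto
    then obtain t where t: "t \<in> {y ?n..z ?n}" "(f ^^ m) t = p (K + i)"
      using coord_mem[OF p(1), of "K + i"] by (metis imageE)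
    have "connected ((\<lambda>y. y ?n) ` C)"
      using \<open>connected C\<close> by (intro connected_continuous_image coord_cont)
    then have "{y ?n..z ?n} \<subseteq> (\<lambda>y. y ?n) ` C"
      using that by (intro connected_contains_Icc) auto
    then obtain w where "w \<in> C" "w ?n = t" using t by auto
    then have "w (K + i) = p (K + i)"
      using iterate_coord[of w m "K + i"] t sub by auto
    then show False using K[of "K + i" w] \<open>w \<in> C\<close> by simp
  qed
  show thesis
  proof (rule that[of "K + m"])
    fix n y z assume "K + m \<le> n" "y \<in> C" "z \<in> C"
    moreover from this have "n = K + (n - K - m) + m" by simp
    ultimately show "\<bar>y n - z n\<bar> < \<delta>"
      using short[of y z "n - K - m"] short[of z y "n - K - m"] by auto
  qed
qed

section \<open>Sections through points that are not endpoints\<close>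

text \<open>
  The construction at the heart of the proof: the lifts of \<open>{p N..q N}\<close> to the windows around the
  points \<open>x (N + k)\<close> fit together to a section of the \<open>N\<close>-th coordinate. The first hypothesis is the
  long-zigzag property with its constant \<open>\<epsilon>\<close> made explicit.
\<close>

lemma section_between:
  assumes homeo: "\<forall>n a b. 0 \<le> a \<and> a \<le> b \<and> b \<le> 1 \<and>
        ((f ^^ n) ` {a..b} = {(f ^^ n) a..(f ^^ n) b} \<or> (f ^^ n) ` {a..b} = {(f ^^ n) b..(f ^^ n) a}) \<and>
        (\<forall>x\<in>{a<..<b}. (f ^^ n) x \<notin> {(f ^^ n) a, (f ^^ n) b}) \<and>
        \<bar>(f ^^ n) a - (f ^^ n) b\<bar> < \<epsilon> \<longrightarrow> (\<exists>g. homeomorphism {a..b} ((f ^^ n) ` {a..b}) (f ^^ n) g)"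
    and A: "connected A" "A \<subseteq> X" and B: "connected B" "B \<subseteq> X"
    and x: "x \<in> A" "x \<in> B" and p: "p \<in> A" and q: "q \<in> B"
    and pB: "\<And>y. y \<in> B \<Longrightarrow> y N \<noteq> p N" and qA: "\<And>y. y \<in> A \<Longrightarrow> y N \<noteq> q N"
    and less: "p N < q N" and close: "q N - p N < \<epsilon>"
  shows "\<exists>l u G. l < x N \<and> x N < u \<and> continuous_on {l..u} G \<and>
                 (\<forall>t\<in>{l..u}. G t \<in> X \<and> G t N = t) \<and> G (x N) = x"
proof -
  define l u where "l = p N" and "u = q N"
  have mem: "y \<in> X" if "y \<in> A \<or> y \<in> B" for y using that A B by blast
  have A_img: "connected ((\<lambda>y. y n) ` A)" and B_img: "connected ((\<lambda>y. y n) ` B)" for n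
    using A B by (auto intro!: connected_continuous_image coord_cont)
  have A_less: "y N < u" if "y \<in> A" for y
  proof (rule ccontr)
    assume "\<not> y N < u"
    then have "q N \<in> (\<lambda>y. y N) ` A"
      using connectedD_interval[OF A_img[of N], of "p N" "y N" "q N"] p that less by (auto simp: u_def)
    then show False using qA by force
  qed
  have B_gr: "l < y N" if "y \<in> B" for y
  proof (rule ccontr)
    assume "\<not> l < y N"
    then have "p N \<in> (\<lambda>y. y N) ` B"
      using connectedD_interval[OF B_img[of N], of "y N" "q N" "p N"] q that less by (auto simp: l_def)
    then show False using pB by force
  qed
  have lift: "(f ^^ k) (y (N + k)) = y N" if "y \<in> A \<or> y \<in> B" for y k
    using iterate_coord mem that by blast
  have "\<exists>a\<in>{0..1}. \<exists>b\<in>{0..1}. a < x (N + k) \<and> x (N + k) < b \<and>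
          ((f ^^ k) a = l \<and> (f ^^ k) b = u \<or> (f ^^ k) a = u \<and> (f ^^ k) b = l) \<and>
          (\<forall>t\<in>{a<..<b}. l < (f ^^ k) t \<and> (f ^^ k) t < u)" for k
  proof (rule clean_window[OF iterate_cont connected_Icc A_img _ B_img])
    show "(\<lambda>y. y (N + k)) ` A \<subseteq> {0..1}" "(\<lambda>y. y (N + k)) ` B \<subseteq> {0..1}"
      using coord_mem mem by blast+
    show "p (N + k) \<in> (\<lambda>y. y (N + k)) ` A" "q (N + k) \<in> (\<lambda>y. y (N + k)) ` B"
      "x (N + k) \<in> (\<lambda>y. y (N + k)) ` A" "x (N + k) \<in> (\<lambda>y. y (N + k)) ` B"
      using p q x by auto
    show "(f ^^ k) (p (N + k)) = l" "(f ^^ k) (q (N + k)) = u"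
      using lift p q by (auto simp: l_def u_def)
    show "(f ^^ k) t < u" if "t \<in> (\<lambda>y. y (N + k)) ` A" for t using that lift A_less by auto
    show "l < (f ^^ k) t" if "t \<in> (\<lambda>y. y (N + k)) ` B" for t using that lift B_gr by auto
  qed
  then obtain a b where ab: "\<And>k. a k \<in> {0..1} \<and> b k \<in> {0..1} \<and> a k < x (N + k) \<and> x (N + k) < b k \<and>
          ((f ^^ k) (a k) = l \<and> (f ^^ k) (b k) = u \<or> (f ^^ k) (a k) = u \<and> (f ^^ k) (b k) = l) \<and>
          (\<forall>t\<in>{a k<..<b k}. l < (f ^^ k) t \<and> (f ^^ k) t < u)"
    by metis
  have "l < u" using less by (simp add: l_def u_def)
  have "\<exists>g. homeomorphism {a k..b k} {l..u} (f ^^ k) g" for k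
  proof -
    have sub: "{a k..b k} \<subseteq> {0..1}" using ab[of k] by auto
    have "connected ((f ^^ k) ` {a k..b k})"
      using continuous_on_subset[OF iterate_cont sub] by (intro connected_continuous_image) auto
    moreover have "a k \<in> {a k..b k}" "b k \<in> {a k..b k}" using ab[of k] by auto
    then have "l \<in> (f ^^ k) ` {a k..b k}" "u \<in> (f ^^ k) ` {a k..b k}" using ab[of k] by (metis image_eqI)+
    ultimately have "{l..u} \<subseteq> (f ^^ k) ` {a k..b k}" by (rule connected_contains_Icc)
    moreover have "(f ^^ k) t \<in> {l..u}" if "t \<in> {a k..b k}" for t
    proof -
      have "t = a k \<or> t = b k \<or> t \<in> {a k<..<b k}" using that by auto
      then show ?thesis using ab[of k] \<open>l < u\<close> by (elim disjE) (auto simp: less_imp_le)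
    qed
    ultimately have img: "(f ^^ k) ` {a k..b k} = {l..u}" by blast
    have "\<exists>g. homeomorphism {a k..b k} ((f ^^ k) ` {a k..b k}) (f ^^ k) g"
    proof (rule homeo[THEN spec, THEN spec, THEN spec, THEN mp], intro conjI)
      show "(f ^^ k) ` {a k..b k} = {(f ^^ k) (a k)..(f ^^ k) (b k)} \<or>
            (f ^^ k) ` {a k..b k} = {(f ^^ k) (b k)..(f ^^ k) (a k)}"
        using img ab[of k] by auto
      show "\<forall>x\<in>{a k<..<b k}. (f ^^ k) x \<notin> {(f ^^ k) (a k), (f ^^ k) (b k)}"
      proof
        fix t assume "t \<in> {a k<..<b k}"
        then have "l < (f ^^ k) t" "(f ^^ k) t < u" using ab[of k] by blast+
        then show "(f ^^ k) t \<notin> {(f ^^ k) (a k), (f ^^ k) (b k)}" using ab[of k] by auto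
      qed
      show "\<bar>(f ^^ k) (a k) - (f ^^ k) (b k)\<bar> < \<epsilon>"
        using ab[of k] close \<open>l < u\<close> unfolding l_def u_def by auto
    qed (use ab[of k] in auto)
    then show ?thesis by (simp add: img)
  qed
  then obtain g where g: "\<And>k. homeomorphism {a k..b k} {l..u} (f ^^ k) (g k)" by metis
  \<comment> \<open>On the open window above, the iterate avoids the values at the ends of the window below.\<close>
  have step: "f t \<in> {a k..b k}" if t: "t \<in> {a (Suc k)..b (Suc k)}" for k t
  proof -
    let ?J = "{a (Suc k)<..<b (Suc k)}"
    have sub: "{a (Suc k)..b (Suc k)} \<subseteq> {0..1}" using ab[of "Suc k"] by auto
    have f_cont: "continuous_on {a (Suc k)..b (Suc k)} f" by (rule continuous_on_subset[OF cont sub])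
    then have "continuous_on ?J f" by (rule continuous_on_subset) auto
    then have conn: "connected (f ` ?J)" by (intro connected_continuous_image) auto
    have "f (x (N + Suc k)) = x (N + k)"
      using iterate_coord[of x 1 "N + k"] mem x by simp
    then have base: "x (N + k) \<in> f ` ?J" using ab[of "Suc k"] by (metis greaterThanLessThan_iff image_eqI)
    have "l < (f ^^ k) s \<and> (f ^^ k) s < u" if "s \<in> f ` ?J" for s
      using that ab[of "Suc k"] by (auto simp: funpow_Suc_right simp del: funpow.simps)
    then have "a k \<notin> f ` ?J" "b k \<notin> f ` ?J" using ab[of k] by fastforce+
    then have "f ` ?J \<subseteq> {a k..b k}"
      using connectedD_interval[OF conn _ base, of _ "a k"] connectedD_interval[OF conn base, of _ "b k"] ab[of k]
      by (metis atLeastAtMost_iff less_imp_le linear subsetI)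
    moreover have cl: "closure ?J = {a (Suc k)..b (Suc k)}" using ab[of "Suc k"] by simp
    ultimately have "f ` closure ?J \<subseteq> {a k..b k}"
      using f_cont by (intro image_closure_subset) auto
    then show ?thesis using t cl by blast
  qed
  have lu01: "{l..u} \<subseteq> {0..1}" using coord_mem[of p N] coord_mem[of q N] mem p q by (auto simp: l_def u_def)
  have g_mem: "g k t \<in> {a k..b k}" if "t \<in> {l..u}" for k t
    using homeomorphism_image2[OF g[of k]] that by blast
  have f_g: "(f ^^ k) (g k t) = t" if "t \<in> {l..u}" for k t
    using homeomorphism_apply2[OF g[of k] that] .
  have g_f: "g k ((f ^^ k) s) = s" if "s \<in> {a k..b k}" for k s
    using homeomorphism_apply1[OF g[of k] that] .
  \<comment> \<open>Coordinates below N are forced by coordinate N.\<close>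
  define G where "G t j = (if N \<le> j then g (j - N) t else (f ^^ (N - j)) t)" for t j
  have GN: "G t N = t" if "t \<in> {l..u}" for t using f_g[OF that, of 0] by (simp add: G_def)
  have "continuous_on {l..u} G"
  proof (rule continuous_on_coordinatewise_then_product)
    show "continuous_on {l..u} (\<lambda>t. G t j)" for j
      using homeomorphism_cont2[OF g] continuous_on_subset[OF iterate_cont lu01]
      by (cases "N \<le> j") (simp_all add: G_def)
  qed
  moreover have "G t \<in> X" if t: "t \<in> {l..u}" for t
  proof -
    have "g k t \<in> {0..1}" for k using g_mem[OF t, of k] ab[of k] by auto
    then have "G t j \<in> {0..1}" for j using iterate_mem t lu01 by (auto simp: G_def subset_iff)
    moreover have "f (G t (Suc j)) = G t j" for j
    proof -
      consider "N \<le> j" | "N = Suc j" | "Suc j < N" by linarith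
      then show ?thesis
      proof cases
        case 1
        define k where "k = j - N"
        have "f (g (Suc k) t) \<in> {a k..b k}" using step g_mem[OF t] by blast
        then have "g k ((f ^^ k) (f (g (Suc k) t))) = f (g (Suc k) t)" by (rule g_f)
        moreover have "(f ^^ k) (f (g (Suc k) t)) = t"
          using f_g[OF t, of "Suc k"] by (simp add: funpow_Suc_right del: funpow.simps)
        ultimately show ?thesis using 1 by (simp add: G_def k_def Suc_diff_le)
      next
        case 2
        then show ?thesis using GN[OF t] by (simp add: G_def)
      next
        case 3
        then have "N - j = Suc (N - Suc j)" by simp
        with 3 show ?thesis by (simp add: G_def)
      qed
    qed
    then have "f (G t j) = G t (j - 1)" if "1 \<le> j" for j using that by (cases j) auto
    ultimately show ?thesis by (simp add: inverse_limit_def)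
  qed
  moreover have "G (x N) = x"
  proof
    fix j
    show "G (x N) j = x j"
    proof (cases "N \<le> j")
      case True
      then obtain k where k: "j = N + k" using le_Suc_ex by blast
      have "g k ((f ^^ k) (x (N + k))) = x (N + k)" using ab[of k] by (intro g_f) auto
      then show ?thesis using lift[of x k] x by (simp add: G_def k)
    next
      case False
      then show ?thesis using iterate_coord[of x "N - j" j] mem x by (simp add: G_def)
    qed
  qed
  ultimately show ?thesis using GN A_less[OF x(1)] B_gr[OF x(2)] by blast
qed

lemma local_section_at_non_endpoint:
  assumes lz: "long_zigzag f" and leo: "locally_eventually_onto f"
    and x: "x \<in> X" "x \<notin> endpoints X"
  obtains N l u G where "l < x N" "x N < u" "continuous_on {l..u} G"
    "\<And>t. t \<in> {l..u} \<Longrightarrow> G t \<in> X \<and> G t N = t" "G (x N) = x"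
proof -
  obtain A B where AB: "subcontinuum X A" "subcontinuum X B" "x \<in> A" "x \<in> B"
      and "\<not> A \<subseteq> B" "\<not> B \<subseteq> A"
    using x unfolding endpoints_def by blast
  then obtain p q where p: "p \<in> A" "p \<notin> B" and q: "q \<in> B" "q \<notin> A" by blast
  have A: "connected A" "A \<subseteq> X" "closed A" and B: "connected B" "B \<subseteq> X" "closed B"
    using AB compact_imp_closed unfolding subcontinuum_def by auto
  have X: "p \<in> X" "q \<in> X" using p q A B by auto
  obtain \<epsilon> where "\<epsilon> > 0" and homeo: "\<forall>n a b. 0 \<le> a \<and> a \<le> b \<and> b \<le> 1 \<and>
        ((f ^^ n) ` {a..b} = {(f ^^ n) a..(f ^^ n) b} \<or> (f ^^ n) ` {a..b} = {(f ^^ n) b..(f ^^ n) a}) \<and>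
        (\<forall>x\<in>{a<..<b}. (f ^^ n) x \<notin> {(f ^^ n) a, (f ^^ n) b}) \<and>
        \<bar>(f ^^ n) a - (f ^^ n) b\<bar> < \<epsilon> \<longrightarrow> (\<exists>g. homeomorphism {a..b} ((f ^^ n) ` {a..b}) (f ^^ n) g)"
    using lz unfolding long_zigzag_def by blast
  then have "\<epsilon> / 2 > 0" by simp
  obtain N1 where N1: "\<And>n y. N1 \<le> n \<Longrightarrow> y \<in> B \<Longrightarrow> y n \<noteq> p n"
    using coord_eventually_outside[OF B(3,2) X(1) p(2)] by metis
  obtain N2 where N2: "\<And>n y. N2 \<le> n \<Longrightarrow> y \<in> A \<Longrightarrow> y n \<noteq> q n"
    using coord_eventually_outside[OF A(3,2) X(2) q(2)] by metis
  obtain N3 where N3: "\<And>n y z. N3 \<le> n \<Longrightarrow> y \<in> A \<Longrightarrow> z \<in> A \<Longrightarrow> \<bar>y n - z n\<bar> < \<epsilon> / 2"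
    using proper_subcontinuum_coords_shrink[OF leo AB(1) X(2) q(2) \<open>\<epsilon> / 2 > 0\<close>] by metis
  obtain N4 where N4: "\<And>n y z. N4 \<le> n \<Longrightarrow> y \<in> B \<Longrightarrow> z \<in> B \<Longrightarrow> \<bar>y n - z n\<bar> < \<epsilon> / 2"
    using proper_subcontinuum_coords_shrink[OF leo AB(2) X(1) p(2) \<open>\<epsilon> / 2 > 0\<close>] by metis
  define N where "N = N1 + N2 + N3 + N4"
  have pB: "\<And>y. y \<in> B \<Longrightarrow> y N \<noteq> p N" and qA: "\<And>y. y \<in> A \<Longrightarrow> y N \<noteq> q N"
    using N1[of N] N2[of N] by (auto simp: N_def)
  have "\<bar>p N - x N\<bar> < \<epsilon> / 2" "\<bar>x N - q N\<bar> < \<epsilon> / 2"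
    using N3[of N p x] N4[of N x q] p q AB by (auto simp: N_def)
  then have close: "\<bar>p N - q N\<bar> < \<epsilon>" by linarith
  have "p N \<noteq> q N" using qA[OF p(1)] .
  have "\<exists>l u G. l < x N \<and> x N < u \<and> continuous_on {l..u} G \<and>
                 (\<forall>t\<in>{l..u}. G t \<in> X \<and> G t N = t) \<and> G (x N) = x"
  proof (cases "p N < q N")
    case True
    then show ?thesis
      using close by (intro section_between[OF homeo, of A B x p q N] A B AB p q pB qA) auto
  next
    case False
    then show ?thesis
      using close \<open>p N \<noteq> q N\<close>
      by (intro section_between[OF homeo, of B A x q p N] A B AB p q pB qA) auto
  qed
  then show thesis using that by blast
qed

lemma section_imp_not_L_endpoint:
  assumes lu: "l < x N" "x N < u" and G: "continuous_on {l..u} G"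
    "\<And>t. t \<in> {l..u} \<Longrightarrow> G t \<in> X \<and> G t N = t" "G (x N) = x"
  shows "x \<notin> L_endpoints X"
proof
  assume x: "x \<in> L_endpoints X"
  let ?K = "G ` {l..u}"
  have inj: "inj_on (\<lambda>y. y N) ?K" using G(2) by (auto intro!: inj_onI)
  have ends: "x \<in> ?K" "G l \<in> ?K" "G u \<in> ?K" "G l N = l" "G u N = u"
    using G(2)[of l] G(2)[of u] G(3) lu by (auto intro: image_eqI[of _ _ "x N"])
  have "arc_or_point ?K"
    using G(1) lu inj
    by (intro arc_or_point_if_injective_real_map[OF _ _ _ coord_cont] compact_continuous_image
        connected_continuous_image) auto
  moreover have "?K \<noteq> {y}" for y using ends lu by (metis less_trans less_irrefl singletonD)
  ultimately have "nondegenerate_arc ?K" by (auto simp: arc_or_point_def)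
  moreover have "?K \<subseteq> X" using G(2) by blast
  ultimately have "arc_endpoint ?K x" using x ends unfolding L_endpoints_def by blast
  then show False
    using arc_endpoint_extreme[OF _ coord_cont inj, of x] ends lu by (metis not_le)
qed

text \<open>
  A basic arc need not be unique, so it does not suffice to produce one that has \<open>x\<close> inside: every
  one with \<open>x\<close> as an endpoint has to be excluded, by prolonging it along the section.
\<close>

lemma section_imp_not_B_endpoint:
  assumes lu: "l < x N" "x N < u" and G: "continuous_on {l..u} G"
    "\<And>t. t \<in> {l..u} \<Longrightarrow> G t \<in> X \<and> G t N = t" "G (x N) = x"
  shows "x \<notin> B_endpoints X"
proof
  assume "x \<in> B_endpoints X"
  then obtain A where A: "is_basic_arc X N x A" "arc_endpoint A x" unfolding B_endpoints_def by blast
  then have arc: "arc_or_point A" and sub: "A \<subseteq> X" and "x \<in> A" and inj: "inj_on (\<lambda>y. y N) A"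
    and max: "\<And>C. \<lbrakk>arc_or_point C; C \<subseteq> X; x \<in> C; inj_on (\<lambda>y. y N) C; A \<subseteq> C\<rbrakk> \<Longrightarrow> C = A"
    unfolding is_basic_arc_def Let_def by blast+
  note A_cont = arc_or_point_imp_continuum[OF arc]
  \<comment> \<open>If the projections of the piece and of the arc meet only in \<open>x N\<close>, their union is again a candidate for a basic arc.\<close>
  have extend: "G ` {a..b} \<subseteq> A"
    if ab: "l \<le> a" "a \<le> x N" "x N \<le> b" "b \<le> u"
      and side: "\<And>y t. y \<in> A \<Longrightarrow> t \<in> {a..b} \<Longrightarrow> y N = t \<Longrightarrow> t = x N" for a b
  proof -
    let ?K = "G ` {a..b}"
    have Gab: "continuous_on {a..b} G" using ab by (intro continuous_on_subset[OF G(1)]) auto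
    have G': "G t \<in> X \<and> G t N = t" if "t \<in> {a..b}" for t using G(2) that ab by auto
    have "x \<in> ?K" using G(3) ab by (auto intro: image_eqI[of _ _ "x N"])
    have "compact ?K" "connected ?K"
      using Gab by (auto intro: compact_continuous_image connected_continuous_image)
    have same: "y = z" if y: "y \<in> A" and z: "z \<in> ?K" and eq: "y N = z N" for y z
    proof -
      obtain t where t: "t \<in> {a..b}" "z = G t" using z by blast
      then have "t = x N" using side[OF y t(1)] eq G' by simp
      then show ?thesis using t G(3) eq inj y \<open>x \<in> A\<close> G' by (auto dest: inj_onD)
    qed
    have K_inj: "y = z" if "y \<in> ?K" "z \<in> ?K" "y N = z N" for y z
      using that G' by auto
    have inj': "inj_on (\<lambda>y. y N) (A \<union> ?K)"
    proof (rule inj_onI)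
      fix y z assume "y \<in> A \<union> ?K" "z \<in> A \<union> ?K" "y N = z N"
      then show "y = z" using same[of y z] same[of z y] K_inj[of y z] inj by (auto dest: inj_onD)
    qed
    moreover have "compact (A \<union> ?K)" using A_cont \<open>compact ?K\<close> by blast
    moreover have "connected (A \<union> ?K)"
      using A_cont \<open>connected ?K\<close> \<open>x \<in> A\<close> \<open>x \<in> ?K\<close> by (intro connected_Un) auto
    ultimately have "arc_or_point (A \<union> ?K)"
      using A_cont by (intro arc_or_point_if_injective_real_map[OF _ _ _ coord_cont]) auto
    moreover have "A \<union> ?K \<subseteq> X" using sub G' by blast
    ultimately have "A \<union> ?K = A" using inj' \<open>x \<in> A\<close> by (intro max) auto
    then show ?thesis by blast
  qed
  consider "\<forall>y\<in>A. x N \<le> y N" | "\<forall>y\<in>A. y N \<le> x N"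
    using arc_endpoint_extreme[OF A(2) coord_cont inj] by blast
  then show False
  proof cases
    case 1
    have "G ` {l..x N} \<subseteq> A" using 1 lu by (intro extend) fastforce+
    then have "G l \<in> A" using lu by auto
    then show False using 1 G(2)[of l] lu by fastforce
  next
    case 2
    have "G ` {x N..u} \<subseteq> A" using 2 lu by (intro extend) fastforce+
    then have "G u \<in> A" using lu by auto
    then show False using 2 G(2)[of u] lu by fastforce
  qed
qed

end

theorem theorem4p7:
  fixes f :: "real \<Rightarrow> real"
  assumes "continuous_on {0..1} f" and "f ` {0..1} = {0..1}"
    and "long_zigzag f"
    and "locally_eventually_onto f"
  shows "B_endpoints (inverse_limit f) \<subseteq> endpoints (inverse_limit f) \<and>
         B_endpoints (inverse_limit f) = L_endpoints (inverse_limit f) \<and>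
         L_endpoints (inverse_limit f) = endpoints (inverse_limit f)"
proof -
  interpret interval_surjection f using assms by unfold_locales
  have "x \<notin> L_endpoints X \<and> x \<notin> B_endpoints X" if "x \<in> X" "x \<notin> endpoints X" for x
    using local_section_at_non_endpoint[OF assms(3,4) that]
      section_imp_not_L_endpoint section_imp_not_B_endpoint by metis
  moreover have "L_endpoints X \<subseteq> X" "B_endpoints X \<subseteq> X"
    unfolding L_endpoints_def B_endpoints_def by auto
  ultimately have "L_endpoints X \<subseteq> endpoints X" "B_endpoints X \<subseteq> endpoints X" by blast+
  then show ?thesis using endpoints_subset_L_endpoints[of X] L_endpoints_subset_B_endpoints by blast
qed

end
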